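(* Let $n\ge 1$ and let $\mathcal{S}_n$ denote the class of convex bodies in $\mathbb{R}^n$ that are intersections of Euclidean unit balls, equipped with the Hausdorff distance $\delta$. Let $T:\mathcal{S}_n\to\mathcal{S}_n$ be a bijective isometry with respect to $\delta$. Then there exists a rigid motion $g:\mathbb{R}^n\to\mathbb{R}^n$ such that either $TK=gK$ for all $K\in\mathcal{S}_n$, or $TK=gK^c$ for all $K\in\mathcal{S}_n$.
   Context: A convex body is a compact, convex, non-empty subset of $\mathbb{R}^n$; $\mathbb{R}^n$ carries the Euclidean inner product and norm $\|\cdot\|_2$, and $B_2^n$ is the closed Euclidean unit ball. The Hausdorff distance between convex bodies is $\delta(K_0,K_1)=\inf\{\lambda>0: K_0\subseteq K_1+\lambda B_2^n,\ K_1\subseteq K_0+\lambda B_2^n\}$. $\mathcal{S}_n$ is the set of convex bodies which are intersections of (translates of) Euclidean unit balls. For $K\in\mathcal{S}_n$, the $c$-dual is $K^c=\bigcap_{x\in K}(x+B_2^n)$, equivalently the unique $L\in\mathcal{S}_n$ with $K-L=B_2^n$ (support function $h_{K^c}(u)=1-h_K(-u)$). *)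

theory Defs
  imports "HOL-Analysis.Analysis"
begin

definition ball_bodies :: "'a::euclidean_space set set" where
  "ball_bodies = {K. compact K \<and> convex K \<and> K \<noteq> {} \<and>
      (\<exists>X. K = (\<Inter>x\<in>X. cball x 1))}"

definition c_dual :: "'a::euclidean_space set \<Rightarrow> 'a set" where
  "c_dual K = (\<Inter>x\<in>K. cball x 1)"

definition rigid_motion :: "('a::euclidean_space \<Rightarrow> 'a) \<Rightarrow> bool" where
  "rigid_motion g \<longleftrightarrow> (\<exists>f c. orthogonal_transformation f \<and> (\<forall>x. g x = f x + c))"

definition hausdorff_dist :: "'a::euclidean_space set \<Rightarrow> 'a set \<Rightarrow> real" where
  "hausdorff_dist K0 K1 = Inf {r. r > 0 \<and>
      K0 \<subseteq> {x + y | x y. x \<in> K1 \<and> y \<in> cball 0 r} \<and>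
      K1 \<subseteq> {x + y | x y. x \<in> K0 \<and> y \<in> cball 0 r}}"

end

theory Submission
  imports Defs
begin

text \<open>
  The Hausdorff distance is the supremum distance of support functions \<open>h\<close> on the unit sphere.
  If bodies \<open>L k\<close> escape to infinity in direction \<open>\<phi>\<close>, then \<open>\<delta>(K, L k)\<close> minus a normalising
  constant subconverges to a horofunction \<open>max (h K (- \<phi>) + a) (b - h K \<phi>)\<close>.  Escaping points
  and escaping unit balls yield \<open>h K v\<close> and \<open>1 - h K v\<close>; they are recognised metrically by
  having a constant sum.  Hence an isometry carries each \<open>h K v\<close> to \<open>h (T K) w\<close> or
  \<open>- h (T K) (- w)\<close>, up to an additive constant.  Looking at far away points shows that \<open>w\<close>
  depends on \<open>v\<close> through an orthogonal map.  The width of \<open>T {0}\<close> in a direction is 0 or 2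
  according to which alternative occurs there; since a ball body with one vanishing width is a
  point, the alternative is the same in all directions.
\<close>

section \<open>Support functions\<close>

definition supp_fun :: "'a::euclidean_space set \<Rightarrow> 'a \<Rightarrow> real" where
  "supp_fun K u = Sup ((\<lambda>x. x \<bullet> u) ` K)"

lemma supp_fun_attained:
  assumes "compact K" "K \<noteq> {}"
  obtains x where "x \<in> K" "supp_fun K u = x \<bullet> u" "\<And>y. y \<in> K \<Longrightarrow> y \<bullet> u \<le> x \<bullet> u"
proof -
  have "continuous_on K (\<lambda>x. x \<bullet> u)" by (intro continuous_intros)
  from continuous_attains_sup[OF assms this] obtain x
    where x: "x \<in> K" "\<And>y. y \<in> K \<Longrightarrow> y \<bullet> u \<le> x \<bullet> u" by blast
  then have "supp_fun K u = x \<bullet> u"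
    unfolding supp_fun_def by (intro cSup_eq_maximum) auto
  with x that show thesis by blast
qed

lemma supp_fun_upper: "compact K \<Longrightarrow> x \<in> K \<Longrightarrow> x \<bullet> u \<le> supp_fun K u"
  by (metis supp_fun_attained empty_iff)

lemma supp_fun_least: "K \<noteq> {} \<Longrightarrow> (\<And>x. x \<in> K \<Longrightarrow> x \<bullet> u \<le> c) \<Longrightarrow> supp_fun K u \<le> c"
  unfolding supp_fun_def by (intro cSup_least) auto

lemma supp_fun_singleton [simp]: "supp_fun {x} u = x \<bullet> u"
  by (simp add: supp_fun_def)

lemma supp_fun_cball:
  assumes "norm u = 1" "0 \<le> r"
  shows "supp_fun (cball x r) u = x \<bullet> u + r"
proof (rule antisym)
  show "supp_fun (cball x r) u \<le> x \<bullet> u + r"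
  proof (rule supp_fun_least)
    fix y assume "y \<in> cball x r"
    then have "norm (y - x) \<le> r" by (simp add: dist_norm norm_minus_commute)
    then have "(y - x) \<bullet> u \<le> r"
      using norm_cauchy_schwarz[of "y - x" u] assms by simp
    then show "y \<bullet> u \<le> x \<bullet> u + r" by (simp add: inner_diff_left)
  qed (use assms in auto)
  have "x + r *\<^sub>R u \<in> cball x r" using assms by (simp add: dist_norm)
  then have "(x + r *\<^sub>R u) \<bullet> u \<le> supp_fun (cball x r) u" by (intro supp_fun_upper) auto
  then show "x \<bullet> u + r \<le> supp_fun (cball x r) u"
    using assms by (simp add: inner_add_left dot_square_norm)
qed

text \<open>By strict separation of a point from a closed convex set; only unit vectors are tested
  because the Hausdorff distance compares support functions on the sphere.\<close>

lemma mem_iff_supp_fun: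
  assumes "compact K" "convex K" "K \<noteq> {}"
  shows "y \<in> K \<longleftrightarrow> (\<forall>u. norm u = 1 \<longrightarrow> y \<bullet> u \<le> supp_fun K u)"
proof (intro iffI allI impI)
  assume R: "\<forall>u. norm u = 1 \<longrightarrow> y \<bullet> u \<le> supp_fun K u"
  show "y \<in> K"
  proof (rule ccontr)
    assume "y \<notin> K"
    with assms obtain a b where ab: "a \<bullet> y < b" "\<forall>x\<in>K. b < a \<bullet> x"
      using separating_hyperplane_closed_point[of K y] compact_imp_closed by metis
    have "a \<noteq> 0" using ab assms(3) by force
    \<comment> \<open>The separating functional \<open>a\<close> is smaller at \<open>y\<close> than
      on \<open>K\<close>; the sign flip makes \<open>u\<close> a direction in which
      \<open>y\<close> lies beyond \<open>K\<close>.\<close>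
    define u where "u = - sgn a"
    have nu: "norm u = 1" using \<open>a \<noteq> 0\<close> by (simp add: u_def norm_sgn)
    have iu: "x \<bullet> u = - (a \<bullet> x) / norm a" for x
      by (simp add: u_def sgn_div_norm inner_commute field_simps)
    obtain x where x: "x \<in> K" "supp_fun K u = x \<bullet> u" using supp_fun_attained assms by metis
    have "a \<bullet> y < a \<bullet> x" using ab x(1) by force
    then have "x \<bullet> u < y \<bullet> u" using \<open>a \<noteq> 0\<close> by (simp add: iu divide_strict_right_mono)
    then show False using R nu x by force
  qed
qed (use supp_fun_upper assms in blast)

lemma subset_cball_iff_supp_fun:
  assumes "compact K" "K \<noteq> {}"
  shows "K \<subseteq> cball z 1 \<longleftrightarrow> (\<forall>u. norm u = 1 \<longrightarrow> supp_fun K u \<le> z \<bullet> u + 1)"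
proof (intro iffI allI impI)
  fix u :: 'a assume "K \<subseteq> cball z 1" "norm u = 1"
  then show "supp_fun K u \<le> z \<bullet> u + 1"
    using supp_fun_upper[of "cball z 1" _ u] supp_fun_cball[of u 1 z] assms
    by (intro supp_fun_least) auto
next
  assume R: "\<forall>u. norm u = 1 \<longrightarrow> supp_fun K u \<le> z \<bullet> u + 1"
  show "K \<subseteq> cball z 1"
  proof
    fix x assume "x \<in> K"
    then have "x \<bullet> u \<le> supp_fun (cball z 1) u" if "norm u = 1" for u
      using R supp_fun_upper[OF assms(1), of x u] supp_fun_cball[of u 1 z] that by force
    then show "x \<in> cball z 1"
      using mem_iff_supp_fun[of "cball z 1"] by auto
  qed
qed

text \<open>A maximiser for \<open>u\<close> is tested against \<open>u'\<close>. Subtracting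
  \<open>x\<close> makes the Lipschitz constant the radius about \<open>x\<close>, which stays
  bounded when bodies escape to infinity.\<close>

lemma supp_fun_lipschitz:
  assumes "compact K" "K \<noteq> {}" "K \<subseteq> cball x R"
  shows "(supp_fun K u - x \<bullet> u) - (supp_fun K u' - x \<bullet> u') \<le> R * norm (u - u')"
proof -
  obtain y where y: "y \<in> K" "supp_fun K u = y \<bullet> u" using supp_fun_attained assms by metis
  have "y \<bullet> u' \<le> supp_fun K u'" using supp_fun_upper assms y by blast
  moreover have "(y - x) \<bullet> (u - u') \<le> R * norm (u - u')"
  proof -
    have "norm (y - x) \<le> R" using y(1) assms(3) by (auto simp: dist_norm norm_minus_commute)
    then show ?thesis
      by (meson mult_right_mono norm_cauchy_schwarz norm_ge_zero order_trans)
  qed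
  ultimately show ?thesis using y by (simp add: inner_diff_left inner_diff_right)
qed

lemma tendsto_supp_fun:
  assumes "compact K" "K \<noteq> {}" "(u \<longlongrightarrow> l) F"
  shows "((\<lambda>k. supp_fun K (u k)) \<longlongrightarrow> supp_fun K l) F"
proof -
  obtain R where R: "K \<subseteq> cball 0 R"
    using compact_imp_bounded[OF assms(1)] bounded_subset_ballD ball_subset_cball by (metis order_trans)
  have bd: "norm (supp_fun K (u k) - supp_fun K l) \<le> R * norm (u k - l)" for k
    using supp_fun_lipschitz[OF assms(1,2) R, of "u k" l]
      supp_fun_lipschitz[OF assms(1,2) R, of l "u k"]
    by (simp add: norm_minus_commute abs_le_iff)
  have "((\<lambda>k. R * norm (u k - l)) \<longlongrightarrow> R * norm (l - l)) F"
    by (intro tendsto_intros assms)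
  then have "((\<lambda>k. R * norm (u k - l)) \<longlongrightarrow> 0) F" by simp
  then have "((\<lambda>k. supp_fun K (u k) - supp_fun K l) \<longlongrightarrow> 0) F"
    by (rule Lim_null_comparison[rotated]) (use bd in auto)
  then show ?thesis by (simp add: Lim_null[symmetric])
qed

section \<open>The Hausdorff distance in terms of support functions\<close>

text \<open>The Minkowski sum of \<open>L\<close> with the ball is compact and convex, and on the
  unit sphere its support function is that of \<open>L\<close> plus \<open>r\<close>.\<close>

lemma subset_sum_cball_iff_supp_fun:
  assumes "compact K" "convex K" "K \<noteq> {}" "compact L" "convex L" "L \<noteq> {}" "0 \<le> r"
  shows "K \<subseteq> {x + y | x y. x \<in> L \<and> y \<in> cball 0 r} \<longleftrightarrow>
      (\<forall>u. norm u = 1 \<longrightarrow> supp_fun K u \<le> supp_fun L u + r)" (is "K \<subseteq> ?S \<longleftrightarrow> _")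
proof (intro iffI allI impI)
  fix u :: 'a assume K: "K \<subseteq> ?S" and u: "norm u = 1"
  show "supp_fun K u \<le> supp_fun L u + r"
  proof (rule supp_fun_least)
    fix z assume "z \<in> K"
    with K obtain x y where "z = x + y" "x \<in> L" "y \<in> cball 0 r" by blast
    then show "z \<bullet> u \<le> supp_fun L u + r"
      using add_mono[OF supp_fun_upper[OF \<open>compact L\<close>, of x u]
        supp_fun_upper[OF compact_cball, of y 0 r u]] supp_fun_cball[OF u \<open>0 \<le> r\<close>, of 0]
      by (metis add_0 inner_add_left inner_zero_left)
  qed fact
next
  assume R: "\<forall>u. norm u = 1 \<longrightarrow> supp_fun K u \<le> supp_fun L u + r"
  have "compact ?S" using compact_sums[of L "cball 0 r"] assms by simp
  moreover have "?S = (\<Union>x\<in>L. \<Union>y\<in>cball 0 r. {x + y})" by blast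
  then have "convex ?S" using convex_sums[of L "cball 0 r"] assms by simp
  ultimately have S: "compact ?S" "convex ?S" .
  obtain x0 where "x0 \<in> L" using assms by blast
  then have "x0 + 0 \<in> ?S" using \<open>0 \<le> r\<close> centre_in_cball by blast
  then have "?S \<noteq> {}" by blast
  show "K \<subseteq> ?S"
  proof
    fix z assume z: "z \<in> K"
    have "z \<bullet> u \<le> supp_fun ?S u" if u: "norm u = 1" for u
    proof -
      obtain x where x: "x \<in> L" "supp_fun L u = x \<bullet> u" using supp_fun_attained assms by metis
      have "x + r *\<^sub>R u \<in> ?S" using x u assms by force
      from supp_fun_upper[OF S(1) this, of u] have "supp_fun L u + r \<le> supp_fun ?S u"
        using u x by (simp add: inner_add_left dot_square_norm)
      then show ?thesis using supp_fun_upper[OF assms(1) z, of u] R u by force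
    qed
    then show "z \<in> ?S" using mem_iff_supp_fun[OF S \<open>?S \<noteq> {}\<close>] by blast
  qed
qed

lemma hausdorff_dist_supp_fun:
  assumes "compact K" "convex K" "K \<noteq> {}" "compact L" "convex L" "L \<noteq> {}"
  shows "hausdorff_dist K L =
      Inf {r. r > 0 \<and> (\<forall>u. norm u = 1 \<longrightarrow> \<bar>supp_fun K u - supp_fun L u\<bar> \<le> r)}"
proof -
  have "(r > 0 \<and> K \<subseteq> {x + y | x y. x \<in> L \<and> y \<in> cball 0 r} \<and> L \<subseteq> {x + y | x y. x \<in> K \<and> y \<in> cball 0 r})
     \<longleftrightarrow> (r > 0 \<and> (\<forall>u. norm u = 1 \<longrightarrow> \<bar>supp_fun K u - supp_fun L u\<bar> \<le> r))" for r
  proof (cases "r > 0")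
    case True
    then show ?thesis
      using subset_sum_cball_iff_supp_fun[OF assms, of r]
        subset_sum_cball_iff_supp_fun[OF assms(4-6,1-3), of r]
      by (simp add: abs_le_iff algebra_simps) blast
  qed simp
  then show ?thesis unfolding hausdorff_dist_def by simp
qed

lemma hausdorff_dist_le:
  assumes "compact K" "convex K" "K \<noteq> {}" "compact L" "convex L" "L \<noteq> {}" "0 \<le> r"
    and "\<And>u. norm u = 1 \<Longrightarrow> \<bar>supp_fun K u - supp_fun L u\<bar> \<le> r"
  shows "hausdorff_dist K L \<le> r"
\<comment> \<open>The infimum ranges over positive radii only, while \<open>r\<close> may be 0;
  hence the detour through \<open>r + e\<close>.\<close>
proof (rule field_le_epsilon)
  fix e :: real assume "0 < e"
  have "r + e \<in> {r. r > 0 \<and> (\<forall>u. norm u = 1 \<longrightarrow> \<bar>supp_fun K u - supp_fun L u\<bar> \<le> r)}"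
    using assms \<open>0 < e\<close> by force
  then show "hausdorff_dist K L \<le> r + e"
    unfolding hausdorff_dist_supp_fun[OF assms(1-6)]
    by (intro cInf_lower) (auto intro!: bdd_belowI[of _ 0])
qed

lemma supp_fun_diff_le_hausdorff_dist:
  assumes "compact K" "convex K" "K \<noteq> {}" "compact L" "convex L" "L \<noteq> {}" "norm u = 1"
  shows "\<bar>supp_fun K u - supp_fun L u\<bar> \<le> hausdorff_dist K L"
proof -
  obtain R where R: "K \<subseteq> cball 0 R" "L \<subseteq> cball 0 R"
  proof -
    have "bounded (K \<union> L)" using assms compact_imp_bounded by blast
    then obtain R where "K \<union> L \<subseteq> ball 0 R" using bounded_subset_ballD by blast
    then show thesis using that[of R] ball_subset_cball by blast
  qed
  have b: "\<bar>supp_fun M v\<bar> \<le> R" if "norm v = 1" "M \<subseteq> cball 0 R" "compact M" "M \<noteq> {}" for v M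
  proof -
    obtain x where "x \<in> M" "supp_fun M v = x \<bullet> v"
      using supp_fun_attained[OF \<open>compact M\<close> \<open>M \<noteq> {}\<close>] by metis
    then show ?thesis using Cauchy_Schwarz_ineq2[of x v] that by auto
  qed
  \<comment> \<open>On the sphere both support functions are bounded by \<open>R\<close>; the
    summand 1 keeps the radius positive, so the set under the infimum is non-empty.\<close>
  have "\<forall>v. norm v = 1 \<longrightarrow> \<bar>supp_fun K v - supp_fun L v\<bar> \<le> 2 * \<bar>R\<bar> + 1"
    using b[OF _ R(1)] b[OF _ R(2)] assms by (smt (verit))
  then have ne: "{r. r > 0 \<and> (\<forall>u. norm u = 1 \<longrightarrow> \<bar>supp_fun K u - supp_fun L u\<bar> \<le> r)} \<noteq> {}"
    by (auto intro!: exI[of _ "2 * \<bar>R\<bar> + 1"])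
  show ?thesis
    unfolding hausdorff_dist_supp_fun[OF assms(1-6)]
    by (rule cInf_greatest[OF ne]) (use assms in auto)
qed

section \<open>Ball bodies\<close>

lemma ball_bodiesD:
  assumes "K \<in> ball_bodies"
  shows "compact K" "convex K" "K \<noteq> {}"
  using assms by (auto simp: ball_bodies_def)

text \<open>A ball of radius \<open>r\<close> is the intersection of the unit balls centred in the
  concentric ball of radius \<open>1 - r\<close>.\<close>

lemma cball_in_ball_bodies:
  assumes "0 \<le> r" "r \<le> 1"
  shows "cball (x::'a::euclidean_space) r \<in> ball_bodies"
proof -
  have "cball x r = (\<Inter>y\<in>cball x (1 - r). cball y 1)"
  proof (intro equalityI subsetI INT_I)
    fix z y assume "z \<in> cball x r" "y \<in> cball x (1 - r)"
    then show "z \<in> cball y 1" using dist_triangle[of y z x] by (simp add: dist_commute)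
  next
    fix z assume z: "z \<in> (\<Inter>y\<in>cball x (1 - r). cball y 1)"
    show "z \<in> cball x r"
    proof (cases "z = x")
      case False
      \<comment> \<open>Among the admissible centres this is the one farthest from \<open>z\<close>,
        opposite to \<open>z\<close> as seen from \<open>x\<close>.\<close>
      define y where "y = x - (1 - r) *\<^sub>R sgn (z - x)"
      have "y \<in> cball x (1 - r)" using assms False by (simp add: y_def dist_norm norm_sgn)
      then have "dist y z \<le> 1" using z by auto
      moreover have "z - y = (norm (z - x) + (1 - r)) *\<^sub>R sgn (z - x)"
        using False by (simp add: y_def sgn_div_norm scaleR_add_left ring_distribs)
      then have "dist y z = norm (z - x) + (1 - r)"
        using assms False by (simp add: dist_norm norm_minus_commute[of y z] norm_sgn)
      ultimately show ?thesis by (simp add: dist_norm norm_minus_commute)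
    qed (use assms in simp)
  qed
  then have "\<exists>X. cball x r = (\<Inter>y\<in>X. cball y 1)" by (rule exI)
  then show ?thesis using assms by (simp add: ball_bodies_def)
qed

lemma singleton_in_ball_bodies: "{x::'a::euclidean_space} \<in> ball_bodies"
  using cball_in_ball_bodies[of 0 x] by simp

lemma ball_bodies_subset_cball:
  assumes "K \<in> ball_bodies"
  obtains z where "K \<subseteq> cball z 1"
proof -
  obtain X where X: "K = (\<Inter>x\<in>X. cball x 1)" and "compact K"
    using assms by (auto simp: ball_bodies_def)
  then have "X \<noteq> {}" using not_compact_UNIV by auto
  then show thesis using X that by blast
qed

lemma ball_bodies_subset_cball_2:
  assumes "K \<in> ball_bodies" "x \<in> K"
  shows "K \<subseteq> cball x 2"
proof -
  obtain z where z: "K \<subseteq> cball z 1" using ball_bodies_subset_cball assms by blast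
  show ?thesis
  proof
    fix y assume "y \<in> K"
    then have "dist z y \<le> 1" "dist z x \<le> 1" using z assms by auto
    then show "y \<in> cball x 2" using dist_triangle[of x y z] by (simp add: dist_commute)
  qed
qed

text \<open>An enclosing unit ball bounds the support function at \<open>u\<close> and at
  \<open>- u\<close>; its centre cancels in the sum.\<close>

lemma ball_bodies_width_le:
  assumes "K \<in> ball_bodies" "norm u = 1"
  shows "supp_fun K u + supp_fun K (- u) \<le> 2"
proof -
  obtain z where z: "K \<subseteq> cball z 1" using ball_bodies_subset_cball assms by blast
  show ?thesis
    using subset_cball_iff_supp_fun[of K z] z ball_bodiesD[OF assms(1)] assms(2)
    by (smt (verit) inner_minus_right norm_minus_cancel)
qed

lemma width_nonneg:
  assumes "compact K" "K \<noteq> {}"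
  shows "0 \<le> supp_fun K u + supp_fun K (- u)"
proof -
  obtain x where "x \<in> K" using assms by blast
  then show ?thesis using supp_fun_upper[of K x u] supp_fun_upper[of K x "- u"] assms by simp
qed

lemma ball_bodies_supp_fun_le:
  assumes "K \<in> ball_bodies" "x \<in> K" "norm u = 1"
  shows "supp_fun K u \<le> x \<bullet> u + 2"
  using supp_fun_upper[OF ball_bodiesD(1)[OF assms(1)] assms(2), of "- u"]
    ball_bodies_width_le[OF assms(1,3)] by simp

text \<open>If \<open>x\<close> and \<open>y\<close> lie in a unit ball, the parallelogram law puts a small ball around
  their midpoint into it, of a radius that depends only on the distance of \<open>x\<close> and \<open>y\<close>.\<close>
lemma ball_bodies_width_zero:
  assumes K: "K \<in> ball_bodies" and u: "norm u = 1" and w: "supp_fun K u + supp_fun K (- u) = 0"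
  shows "\<exists>p. K = {p}"
proof (rule ccontr)
  assume "\<nexists>p. K = {p}"
  then obtain x y where xy: "x \<in> K" "y \<in> K" "x \<noteq> y" using ball_bodiesD(3)[OF K] by blast
  obtain X where X: "K = (\<Inter>x\<in>X. cball x 1)" using K by (auto simp: ball_bodies_def)
  define m where "m = (1/2) *\<^sub>R (x + y)"
  define r where "r = 1 - sqrt (1 - (norm (x - y))\<^sup>2 / 4)"
  have "r > 0" using xy(3) by (simp add: r_def)
  have "cball m r \<subseteq> K"
    unfolding X
  proof (intro INT_greatest subsetI)
    fix z q assume "z \<in> X" and q: "q \<in> cball m r"
    then have d: "norm (x - z) \<le> 1" "norm (y - z) \<le> 1"
      using xy X by (auto simp: dist_norm norm_minus_commute)
    have "(norm (m - z))\<^sup>2 = (norm (x - z))\<^sup>2 / 2 + (norm (y - z))\<^sup>2 / 2 - (norm (x - y))\<^sup>2 / 4"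
      by (simp add: m_def power2_norm_eq_inner inner_simps inner_commute field_simps)
    also have "\<dots> \<le> 1 - (norm (x - y))\<^sup>2 / 4"
      using d power_mono[of _ "1::real" 2] by (smt (verit) field_sum_of_halves norm_ge_zero one_power2)
    finally have "norm (m - z) \<le> sqrt (1 - (norm (x - y))\<^sup>2 / 4)"
      by (rule real_le_rsqrt)
    then show "q \<in> cball z 1"
      using q dist_triangle[of z q m] by (simp add: r_def dist_norm norm_minus_commute)
  qed
  \<comment> \<open>These two points of \<open>K\<close> force a width of at least
    \<open>2 * r\<close> in direction \<open>u\<close>.\<close>
  then have "m + r *\<^sub>R u \<in> K" "m - r *\<^sub>R u \<in> K" using u \<open>r > 0\<close> by (auto simp: dist_norm subset_iff)
  then have "(m + r *\<^sub>R u) \<bullet> u + (m - r *\<^sub>R u) \<bullet> (- u) \<le> 0"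
    using supp_fun_upper[OF ball_bodiesD(1)[OF K]] w by (metis add_mono)
  then show False using u \<open>r > 0\<close> by (simp add: inner_add_left inner_diff_left dot_square_norm)
qed

text \<open>For \<open>x\<close> in a ball body, \<open>supp_fun K u - x \<bullet> u\<close> lies
  between 0 and 2. So distances of bodies and of points chosen in them agree up to 2, and escape to
  infinity can be measured by points.\<close>

lemma hausdorff_dist_le_norm:
  assumes "K \<in> ball_bodies" "L \<in> ball_bodies" "x \<in> K" "y \<in> L"
  shows "hausdorff_dist K L \<le> norm (x - y) + 2"
proof (rule hausdorff_dist_le)
  fix u :: 'a assume u: "norm u = 1"
  have "\<bar>(x - y) \<bullet> u\<bar> \<le> norm (x - y)" using Cauchy_Schwarz_ineq2[of "x - y" u] u by simp
  then show "\<bar>supp_fun K u - supp_fun L u\<bar> \<le> norm (x - y) + 2"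
    using ball_bodies_supp_fun_le[OF assms(1,3) u] ball_bodies_supp_fun_le[OF assms(2,4) u]
      supp_fun_upper[OF ball_bodiesD(1)[OF assms(1)] assms(3), of u]
      supp_fun_upper[OF ball_bodiesD(1)[OF assms(2)] assms(4), of u]
    by (simp add: inner_diff_left)
qed (use ball_bodiesD assms in auto)

lemma norm_le_hausdorff_dist:
  assumes "K \<in> ball_bodies" "L \<in> ball_bodies" "x \<in> K" "y \<in> L"
  shows "norm (x - y) \<le> hausdorff_dist K L + 2"
proof (cases "x = y")
  case True
  then show ?thesis
    using supp_fun_diff_le_hausdorff_dist[of K L "SOME b. b \<in> Basis"] ball_bodiesD assms
    by (smt (verit) SOME_Basis norm_Basis norm_zero right_minus_eq)
next
  case False
  define u where "u = sgn (x - y)"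
  have u: "norm u = 1" using False by (simp add: u_def norm_sgn)
  have "(x - y) \<bullet> u = norm (x - y)"
    using False by (simp add: u_def sgn_div_norm dot_square_norm power2_eq_square)
  then show ?thesis
    using ball_bodies_supp_fun_le[OF assms(2,4) u]
      supp_fun_upper[OF ball_bodiesD(1)[OF assms(1)] assms(3), of u]
      supp_fun_diff_le_hausdorff_dist[OF ball_bodiesD[OF assms(1)] ball_bodiesD[OF assms(2)] u]
    by (simp add: inner_diff_left)
qed

section \<open>Limits of distance functions\<close>

text \<open>The quadratic term is the curvature of the sphere: at distance \<open>e\<close> from the direction
  \<open>\<theta>\<close> the inner product with \<open>r *\<^sub>R \<theta>\<close> drops by \<open>r * e\<^sup>2 / 2\<close>, which beats the
  Lipschitz growth \<open>(R + 2) * e\<close> of the support functions up to \<open>(R + 2)\<^sup>2 / (2 * r)\<close>.\<close>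
lemma hausdorff_dist_far:
  assumes M: "M \<in> ball_bodies" and R: "M \<subseteq> cball 0 R" and L: "L \<in> ball_bodies"
    and x: "x \<in> L" "x \<noteq> 0"
    and a: "a = supp_fun L (- sgn x) + norm x" and b: "b = supp_fun L (sgn x) - norm x"
  defines "m \<equiv> max (supp_fun M (- sgn x) - a) (b - supp_fun M (sgn x))"
  shows "m \<le> hausdorff_dist M L - norm x"
    and "0 \<le> norm x + m \<Longrightarrow> hausdorff_dist M L - norm x \<le> m + (R + 2)\<^sup>2 / (2 * norm x)"
proof -
  note cvx = ball_bodiesD[OF M] ball_bodiesD[OF L]
  define r where "r = norm x"
  define t where "t = sgn x"
  have r: "r > 0" and t: "norm t = 1" and xrt: "x = r *\<^sub>R t"
    using x by (simp_all add: r_def t_def norm_sgn sgn_div_norm)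
  note a = a[folded t_def r_def] and b = b[folded t_def r_def]
  have m: "m = max (supp_fun M (- t) - a) (b - supp_fun M t)" by (simp add: m_def t_def)
  \<comment> \<open>\<open>a\<close> and \<open>b\<close> are the support values of \<open>L\<close>
    translated by \<open>- x\<close> at \<open>- t\<close> and \<open>t\<close>. Hence
    \<open>norm x + m\<close> is the larger of two differences of support functions, taken at
    \<open>- t\<close> and \<open>t\<close>.\<close>
  show "m \<le> hausdorff_dist M L - norm x"
    using supp_fun_diff_le_hausdorff_dist[OF cvx, of t] supp_fun_diff_le_hausdorff_dist[OF cvx, of "- t"] t
    unfolding m a b r_def[symmetric] by (simp add: abs_le_iff)
  assume pos: "0 \<le> norm x + m"
  have quad: "(R + 2) * e - r * (e\<^sup>2 / 2) \<le> (R + 2)\<^sup>2 / (2 * r)" for e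
  proof -
    have "0 \<le> (r * e - (R + 2))\<^sup>2 / (2 * r)" using r by simp
    also have "\<dots> = (R + 2)\<^sup>2 / (2 * r) - ((R + 2) * e - r * (e\<^sup>2 / 2))"
      using r by (simp add: field_simps power2_eq_square)
    finally show ?thesis by simp
  qed
  have "hausdorff_dist M L \<le> r + m + (R + 2)\<^sup>2 / (2 * r)"
  proof (rule hausdorff_dist_le[OF cvx])
    show "0 \<le> r + m + (R + 2)\<^sup>2 / (2 * r)" using pos r by (simp add: r_def)
  next
    fix u :: 'a assume u: "norm u = 1"
    have L2: "L \<subseteq> cball x 2" using ball_bodies_subset_cball_2 L x by blast
    have sq: "(norm (u - w))\<^sup>2 = 2 - 2 * (u \<bullet> w)" if "norm w = 1" for w
      using dot_norm_neg[of u w] u that by simp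
    have xt: "x \<bullet> v = r * (v \<bullet> t)" for v by (simp add: xrt inner_commute)
    have tt: "t \<bullet> t = 1" using t by (simp add: dot_square_norm)
    \<comment> \<open>The two signs of the difference are bounded separately: the excess of
      \<open>M\<close> over \<open>L\<close> is compared with its value at \<open>- t\<close>, that
      of \<open>L\<close> over \<open>M\<close> with its value at \<open>t\<close>.\<close>
    define e where "e = norm (u + t)"
    define e' where "e' = norm (u - t)"
    have ut: "u \<bullet> t = e\<^sup>2 / 2 - 1" "u \<bullet> t = 1 - e'\<^sup>2 / 2"
      using sq[of "- t"] sq[of t] t by (simp_all add: e_def e'_def field_simps)
    have "supp_fun M u - supp_fun M (- t) \<le> R * e"
      using supp_fun_lipschitz[OF cvx(1,3) R, of u "- t"] by (simp add: e_def)
    moreover have "(supp_fun L (- t) + r) - (supp_fun L u - x \<bullet> u) \<le> 2 * e"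
      using supp_fun_lipschitz[OF cvx(4,6) L2, of "- t" u] tt
      by (simp add: e_def xt norm_minus_commute[of "-t"])
    moreover have "x \<bullet> u = r * (e\<^sup>2 / 2) - r" unfolding xt ut(1) by (simp add: algebra_simps)
    ultimately have 1: "supp_fun M u - supp_fun L u \<le> r + m + (R + 2)\<^sup>2 / (2 * r)"
      using quad[of e] unfolding m a by (simp add: algebra_simps)
    have "supp_fun M t - supp_fun M u \<le> R * e'"
      using supp_fun_lipschitz[OF cvx(1,3) R, of t u] by (simp add: e'_def norm_minus_commute)
    moreover have "(supp_fun L u - x \<bullet> u) - (supp_fun L t - r) \<le> 2 * e'"
      using supp_fun_lipschitz[OF cvx(4,6) L2, of u t] tt by (simp add: e'_def xt)
    moreover have "x \<bullet> u = r - r * (e'\<^sup>2 / 2)" unfolding xt ut(2) by (simp add: algebra_simps)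
    ultimately have "supp_fun L u - supp_fun M u \<le> r + m + (R + 2)\<^sup>2 / (2 * r)"
      using quad[of e'] unfolding m b by (simp add: algebra_simps)
    with 1 show "\<bar>supp_fun M u - supp_fun L u\<bar> \<le> r + m + (R + 2)\<^sup>2 / (2 * r)" by simp
  qed
  then show "hausdorff_dist M L - norm x \<le> m + (R + 2)\<^sup>2 / (2 * norm x)" by (simp add: r_def)
qed

text \<open>The error in the two-sided estimate for far bodies vanishes as \<open>norm (x k)\<close>
  grows, and continuity of \<open>supp_fun M\<close> gives the limit of the main term.\<close>

lemma hausdorff_dist_horofunction:
  assumes M: "M \<in> ball_bodies" and L: "\<And>k. L k \<in> ball_bodies" and x: "\<And>k. x k \<in> L k"
    and inf: "filterlim (\<lambda>k. norm (x k)) at_top sequentially"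
    and \<phi>: "(\<lambda>k. sgn (x k)) \<longlonglongrightarrow> \<phi>"
    and a: "(\<lambda>k. supp_fun (L k) (- sgn (x k)) + norm (x k)) \<longlonglongrightarrow> a"
    and b: "(\<lambda>k. supp_fun (L k) (sgn (x k)) - norm (x k)) \<longlonglongrightarrow> b"
  shows "(\<lambda>k. hausdorff_dist M (L k) - norm (x k))
    \<longlonglongrightarrow> max (supp_fun M (- \<phi>) - a) (b - supp_fun M \<phi>)"
proof -
  obtain R where R: "M \<subseteq> cball 0 R"
    using compact_imp_bounded[OF ball_bodiesD(1)[OF M]] bounded_subset_ballD ball_subset_cball
    by (metis order_trans)
  define m where "m k = max (supp_fun M (- sgn (x k)) - (supp_fun (L k) (- sgn (x k)) + norm (x k)))
     ((supp_fun (L k) (sgn (x k)) - norm (x k)) - supp_fun M (sgn (x k)))" for k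
  have lim: "m \<longlonglongrightarrow> max (supp_fun M (- \<phi>) - a) (b - supp_fun M \<phi>)"
    unfolding m_def by (intro tendsto_intros tendsto_supp_fun a b \<phi> ball_bodiesD[OF M])
  have "((\<lambda>k. (R + 2)\<^sup>2 / (2 * norm (x k))) \<longlongrightarrow> 0) sequentially"
    by (intro real_tendsto_divide_at_top[OF tendsto_const] filterlim_tendsto_pos_mult_at_top[OF tendsto_const _ inf]) simp
  from tendsto_add[OF lim this]
  have lim2: "(\<lambda>k. m k + (R + 2)\<^sup>2 / (2 * norm (x k)))
      \<longlonglongrightarrow> max (supp_fun M (- \<phi>) - a) (b - supp_fun M \<phi>)" by simp
  have ev0: "\<forall>\<^sub>F k in sequentially. 0 < norm (x k)"
    using inf unfolding filterlim_at_top_dense by blast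
  have "filterlim (\<lambda>k. m k + norm (x k)) at_top sequentially"
    by (rule filterlim_tendsto_add_at_top[OF lim inf])
  then have ev1: "\<forall>\<^sub>F k in sequentially. 0 \<le> m k + norm (x k)"
    by (simp add: filterlim_at_top)
  show ?thesis
  proof (rule tendsto_sandwich[OF _ _ lim lim2])
    show "\<forall>\<^sub>F k in sequentially. m k \<le> hausdorff_dist M (L k) - norm (x k)"
      using ev0
    proof eventually_elim
      case (elim k)
      then show ?case
        unfolding m_def using hausdorff_dist_far(1)[OF M R L x _ refl refl] by simp
    qed
    show "\<forall>\<^sub>F k in sequentially. hausdorff_dist M (L k) - norm (x k) \<le> m k + (R + 2)\<^sup>2 / (2 * norm (x k))"
      using ev0 ev1
    proof eventually_elim
      case (elim k)
      then show ?case
        unfolding m_def using hausdorff_dist_far(2)[OF M R L x _ refl refl, of k]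
        by (simp add: add.commute)
    qed
  qed
qed

section \<open>Horofunctions of escaping points and escaping unit balls\<close>

lemma filterlim_norm_of_nat_scaleR:
  assumes "norm v = 1"
  shows "filterlim (\<lambda>k. norm (of_nat k *\<^sub>R v)) at_top sequentially"
  using assms filterlim_real_sequentially by simp

lemma sgn_of_nat_scaleR:
  assumes "norm v = 1"
  shows "(\<lambda>k. sgn (of_nat k *\<^sub>R v)) \<longlonglongrightarrow> v"
proof (rule tendsto_eventually)
  show "\<forall>\<^sub>F k in sequentially. sgn (of_nat k *\<^sub>R v) = v"
    using eventually_gt_at_top[of 0] by eventually_elim (use assms in \<open>simp add: sgn_div_norm\<close>)
qed

text \<open>Here both limits \<open>a\<close> and \<open>b\<close> are 0, and non-negativity of the
  width decides the maximum.\<close>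

lemma horofunction_points:
  assumes K: "K \<in> ball_bodies" and v: "norm v = 1"
  shows "(\<lambda>k. hausdorff_dist K {of_nat k *\<^sub>R (- v)} - of_nat k) \<longlonglongrightarrow> supp_fun K v"
proof -
  have v': "norm (- v) = 1" using v by simp
  have e: "\<forall>\<^sub>F k in sequentially. sgn (real k *\<^sub>R (- v)) = - v"
    using eventually_gt_at_top[of 0] by eventually_elim (use v in \<open>simp add: sgn_div_norm\<close>)
  have "(\<lambda>k. hausdorff_dist K {of_nat k *\<^sub>R (- v)} - norm (real k *\<^sub>R (- v)))
     \<longlonglongrightarrow> max (supp_fun K (- (- v)) - 0) (0 - supp_fun K (- v))"
  proof (rule hausdorff_dist_horofunction[OF K singleton_in_ball_bodies _
        filterlim_norm_of_nat_scaleR[OF v'] sgn_of_nat_scaleR[OF v']])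
    show "(\<lambda>k. supp_fun {real k *\<^sub>R (- v)} (- sgn (real k *\<^sub>R (- v))) + norm (real k *\<^sub>R (- v))) \<longlonglongrightarrow> 0"
      by (rule tendsto_eventually, use e in eventually_elim) (simp add: v dot_square_norm)
    show "(\<lambda>k. supp_fun {real k *\<^sub>R (- v)} (sgn (real k *\<^sub>R (- v))) - norm (real k *\<^sub>R (- v))) \<longlonglongrightarrow> 0"
      by (rule tendsto_eventually, use e in eventually_elim) (simp add: v dot_square_norm)
  qed simp
  moreover have "max (supp_fun K (- (- v)) - 0) (0 - supp_fun K (- v)) = supp_fun K v"
    using width_nonneg[OF ball_bodiesD(1,3)[OF K], of v] by simp
  ultimately show ?thesis using v by simp
qed

text \<open>Here both limits are 1, and the bound 2 on the width decides the maximum.\<close>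

lemma horofunction_balls:
  assumes K: "K \<in> ball_bodies" and v: "norm v = 1"
  shows "(\<lambda>k. hausdorff_dist K (cball (of_nat k *\<^sub>R v) 1) - of_nat k) \<longlonglongrightarrow> 1 - supp_fun K v"
proof -
  have e: "\<forall>\<^sub>F k in sequentially. sgn (real k *\<^sub>R v) = v"
    using eventually_gt_at_top[of 0] by eventually_elim (use v in \<open>simp add: sgn_div_norm\<close>)
  have "(\<lambda>k. hausdorff_dist K (cball (real k *\<^sub>R v) 1) - norm (real k *\<^sub>R v))
     \<longlonglongrightarrow> max (supp_fun K (- v) - 1) (1 - supp_fun K v)"
  proof (rule hausdorff_dist_horofunction[OF K cball_in_ball_bodies _
        filterlim_norm_of_nat_scaleR[OF v] sgn_of_nat_scaleR[OF v]])
    show "(\<lambda>k. supp_fun (cball (real k *\<^sub>R v) 1) (- sgn (real k *\<^sub>R v)) + norm (real k *\<^sub>R v)) \<longlonglongrightarrow> 1"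
      by (rule tendsto_eventually, use e in eventually_elim) (simp add: v supp_fun_cball dot_square_norm)
    show "(\<lambda>k. supp_fun (cball (real k *\<^sub>R v) 1) (sgn (real k *\<^sub>R v)) - norm (real k *\<^sub>R v)) \<longlonglongrightarrow> 1"
      by (rule tendsto_eventually, use e in eventually_elim) (simp add: v supp_fun_cball dot_square_norm)
  qed simp_all
  moreover have "max (supp_fun K (- v) - 1) (1 - supp_fun K v) = 1 - supp_fun K v"
    using ball_bodies_width_le[OF K v] by simp
  ultimately show ?thesis using v by simp
qed

section \<open>The action of an isometry on support functions\<close>

text \<open>The bodies \<open>T (P k)\<close> have the same distances as the \<open>P k\<close>, so
  they escape at the same rate. Compactness yields a subsequence along which directions and
  normalised support values converge.\<close>

lemma horofunction_image:
  fixes T :: "'a::euclidean_space set \<Rightarrow> 'a set"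
  assumes T: "\<And>K. K \<in> ball_bodies \<Longrightarrow> T K \<in> ball_bodies"
    and iso: "\<And>K L. K \<in> ball_bodies \<Longrightarrow> L \<in> ball_bodies \<Longrightarrow>
                hausdorff_dist (T K) (T L) = hausdorff_dist K L"
    and P: "\<And>k. P k \<in> ball_bodies"
    and f: "\<And>K. K \<in> ball_bodies \<Longrightarrow> (\<lambda>k. hausdorff_dist K (P k) - of_nat k) \<longlonglongrightarrow> f K"
  obtains \<phi> a b where "norm \<phi> = 1"
    "\<And>K. K \<in> ball_bodies \<Longrightarrow> f K = max (supp_fun (T K) (- \<phi>) + a) (b - supp_fun (T K) \<phi>)"
proof -
  define L where "L k = T (P k)" for k
  have L: "L k \<in> ball_bodies" for k by (simp add: L_def T P)
  have "\<forall>k. \<exists>x. x \<in> L k" using ball_bodiesD(3)[OF L] by blast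
  then obtain x where x: "\<And>k. x k \<in> L k" by metis
  obtain C where C: "\<bar>hausdorff_dist (P 0) (P k) - of_nat k\<bar> \<le> C" for k
    using convergent_imp_bounded[OF f[OF P[of 0]]] by (auto simp: bounded_iff)
  \<comment> \<open>The normalisations by \<open>norm (x k)\<close> and by \<open>k\<close> differ
    by a bounded amount; its limit \<open>d0\<close> is absorbed into the final constants.\<close>
  define d where "d k = norm (x k) - of_nat k" for k
  have d: "\<bar>d k\<bar> \<le> C + 2 + norm (x 0)" for k
    using hausdorff_dist_le_norm[OF L L x x, of 0 k] norm_le_hausdorff_dist[OF L L x x, of 0 k] C[of k]
      norm_triangle_ineq2[of "x 0" "x k"] norm_triangle_ineq2[of "x k" "x 0"] norm_triangle_ineq4[of "x 0" "x k"]
    by (simp add: L_def iso P d_def norm_minus_commute[of "x k"])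
  define a' where "a' k = supp_fun (L k) (- sgn (x k)) + norm (x k)" for k
  define b' where "b' k = supp_fun (L k) (sgn (x k)) - norm (x k)" for k
  have ab: "\<bar>a' k\<bar> \<le> 2 \<and> \<bar>b' k\<bar> \<le> 2" for k
  proof (cases "x k = 0")
    case True
    have "supp_fun (L k) 0 = 0"
      using supp_fun_attained[OF ball_bodiesD(1,3)[OF L[of k]], of 0] by simp
    then show ?thesis using True by (simp add: a'_def b'_def)
  next
    case False
    then have n: "norm (sgn (x k)) = 1" "norm (- sgn (x k)) = 1" by (auto simp: norm_sgn)
    have s: "x k \<bullet> sgn (x k) = norm (x k)"
      using False by (simp add: sgn_div_norm dot_square_norm power2_eq_square)
    show ?thesis
      using ball_bodies_supp_fun_le[OF L x n(1), of k] ball_bodies_supp_fun_le[OF L x n(2), of k]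
        supp_fun_upper[OF ball_bodiesD(1)[OF L] x, of k "sgn (x k)"]
        supp_fun_upper[OF ball_bodiesD(1)[OF L] x, of k "- sgn (x k)"] s
      by (simp add: a'_def b'_def)
  qed
  have "bounded (range (\<lambda>k. (sgn (x k), a' k, b' k, d k)))"
  proof -
    have "range (\<lambda>k. (sgn (x k), a' k, b' k, d k))
       \<subseteq> cball 0 1 \<times> {-2..2} \<times> {-2..2} \<times> {-(C + 2 + norm (x 0))..C + 2 + norm (x 0)}"
      (is "_ \<subseteq> ?S")
    proof (rule image_subsetI)
      fix k
      show "(sgn (x k), a' k, b' k, d k) \<in> ?S"
        using ab[of k] d[of k] by (auto simp: abs_le_iff norm_sgn)
    qed
    then show ?thesis
      by (rule bounded_subset[rotated]) (intro bounded_Times bounded_cball bounded_closed_interval)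
  qed
  from bounded_imp_convergent_subsequence[OF this] obtain l r
    where r: "strict_mono r" and l: "((\<lambda>k. (sgn (x k), a' k, b' k, d k)) \<circ> r) \<longlonglongrightarrow> l" by blast
  obtain \<phi> a b d0 where "l = (\<phi>, a, b, d0)" by (metis prod.exhaust)
  with l have lims: "(\<lambda>k. sgn (x (r k))) \<longlonglongrightarrow> \<phi>" "(\<lambda>k. a' (r k)) \<longlonglongrightarrow> a" "(\<lambda>k. b' (r k)) \<longlonglongrightarrow> b"
      "(\<lambda>k. d (r k)) \<longlonglongrightarrow> d0"
    using tendsto_fst[OF l] tendsto_fst[OF tendsto_snd[OF l]] tendsto_fst[OF tendsto_snd[OF tendsto_snd[OF l]]]
      tendsto_snd[OF tendsto_snd[OF tendsto_snd[OF l]]]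
    by (simp_all add: o_def)
  have "filterlim (\<lambda>k. real (r k)) at_top sequentially"
    using filterlim_compose[OF filterlim_real_sequentially filterlim_subseq[OF r]] .
  from filterlim_tendsto_add_at_top[OF lims(4) this]
  have inf: "filterlim (\<lambda>k. norm (x (r k))) at_top sequentially" by (simp add: d_def)
  then have "\<forall>\<^sub>F k in sequentially. norm (x (r k)) > 0"
    unfolding filterlim_at_top_dense by blast
  then have "\<forall>\<^sub>F k in sequentially. norm (sgn (x (r k))) = 1"
    by eventually_elim (simp add: norm_sgn)
  then have "(\<lambda>k. norm (sgn (x (r k)))) \<longlonglongrightarrow> 1" by (rule tendsto_eventually)
  with tendsto_norm[OF lims(1)] have "norm \<phi> = 1" by (rule LIMSEQ_unique)
  show thesis
  proof (rule that[of \<phi> "d0 - a" "b + d0"])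
    fix K :: "'a set" assume K: "K \<in> ball_bodies"
    have 1: "(\<lambda>k. hausdorff_dist (T K) (L (r k)) - norm (x (r k)))
       \<longlonglongrightarrow> max (supp_fun (T K) (- \<phi>) - a) (b - supp_fun (T K) \<phi>)"
      using lims(2,3) unfolding a'_def b'_def
      by (intro hausdorff_dist_horofunction T K L x inf lims(1))
    have "(\<lambda>k. hausdorff_dist K (P (r k)) - of_nat (r k)) \<longlonglongrightarrow> f K"
      using LIMSEQ_subseq_LIMSEQ[OF f[OF K] r] by (simp add: o_def)
    from tendsto_diff[OF this lims(4)]
    have 2: "(\<lambda>k. hausdorff_dist (T K) (L (r k)) - norm (x (r k))) \<longlonglongrightarrow> f K - d0"
      by (simp add: d_def L_def iso K P)
    from LIMSEQ_unique[OF 1 2]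
    show "f K = max (supp_fun (T K) (- \<phi>) + (d0 - a)) (b + d0 - supp_fun (T K) \<phi>)" by simp
  qed fact
qed

text \<open>The images of the horofunctions \<open>h K v\<close> and \<open>1 - h K v\<close> sum to 1.  Evaluated on centred
  balls both are convex functions of the radius, which forces them to be affine there, so that
  each maximum is attained by the same term for all bodies.\<close>
lemma isometry_supp_fun:
  fixes T :: "'a::euclidean_space set \<Rightarrow> 'a set"
  assumes bij: "bij_betw T ball_bodies ball_bodies"
    and iso: "\<And>K L. K \<in> ball_bodies \<Longrightarrow> L \<in> ball_bodies \<Longrightarrow>
                hausdorff_dist (T K) (T L) = hausdorff_dist K L"
    and v: "norm v = 1"
  shows "\<exists>w c. norm w = 1 \<and>
     ((\<forall>K\<in>ball_bodies. supp_fun K v = supp_fun (T K) w + c) \<or>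
      (\<forall>K\<in>ball_bodies. supp_fun K v = c - supp_fun (T K) (- w)))"
proof -
  have T: "\<And>K. K \<in> ball_bodies \<Longrightarrow> T K \<in> ball_bodies" using bij bij_betwE by blast
  obtain \<phi> a b where \<phi>: "norm \<phi> = 1" and f:
    "\<And>K. K \<in> ball_bodies \<Longrightarrow> supp_fun K v = max (supp_fun (T K) (- \<phi>) + a) (b - supp_fun (T K) \<phi>)"
    by (rule horofunction_image[OF T iso singleton_in_ball_bodies horofunction_points[OF _ v]]) blast+
  obtain \<psi> a' b' where \<psi>: "norm \<psi> = 1" and g:
    "\<And>K. K \<in> ball_bodies \<Longrightarrow> 1 - supp_fun K v = max (supp_fun (T K) (- \<psi>) + a') (b' - supp_fun (T K) \<psi>)"
    by (rule horofunction_image[OF T iso cball_in_ball_bodies horofunction_balls[OF _ v]]) auto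
  have sum: "max (supp_fun M (- \<phi>) + a) (b - supp_fun M \<phi>) + max (supp_fun M (- \<psi>) + a') (b' - supp_fun M \<psi>) = 1"
    if M: "M \<in> ball_bodies" for M
  proof -
    have "M \<in> T ` ball_bodies" using M bij_betw_imp_surj_on[OF bij] by simp
    then obtain K where K: "K \<in> ball_bodies" "T K = M" by blast
    show ?thesis
      unfolding f[OF K(1), unfolded K(2), symmetric] g[OF K(1), unfolded K(2), symmetric] by simp
  qed
  have pt: "max a b + max a' b' = 1 + y \<bullet> (\<phi> + \<psi>)" for y
  proof -
    have "max (c - p) (e - p) = max c e - p" for c e p :: real by simp
    from this[of a "y \<bullet> \<phi>" b] this[of a' "y \<bullet> \<psi>" b'] sum[OF singleton_in_ball_bodies, of y]
    show ?thesis by (simp add: inner_add_right)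
  qed
  \<comment> \<open>The left side of \<open>pt\<close> does not depend on \<open>y\<close>, so
    neither does the right side.\<close>
  from pt[of 0] pt[of "\<phi> + \<psi>"] have "(\<phi> + \<psi>) \<bullet> (\<phi> + \<psi>) = 0" by simp
  then have \<psi>\<phi>: "\<psi> = - \<phi>" by (simp add: eq_neg_iff_add_eq_0 add.commute)
  have ball: "max (\<rho> + a) (b - \<rho>) + max (\<rho> + a') (b' - \<rho>) = 1" if "0 \<le> \<rho>" "\<rho> \<le> 1" for \<rho>
    using sum[OF cball_in_ball_bodies[OF that], of 0] \<phi> that by (simp add: \<psi>\<phi> supp_fun_cball)
  \<comment> \<open>The first maximum in \<open>ball\<close> has its kink at radius
    \<open>(b - a) / 2\<close>. Strictly between 0 and 1 it could not be compensated by the other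
    convex summand.\<close>
  have "a \<ge> b \<or> a \<le> b - 2"
  proof (rule ccontr)
    assume *: "\<not> ?thesis"
    then have "0 \<le> (b - a) / 2" "(b - a) / 2 \<le> 1" by auto
    from ball[OF this] ball[of 0] ball[of 1] * show False
      by (simp add: max_def split: if_splits)
  qed
  then show ?thesis
  proof
    assume "a \<ge> b"
    then have "supp_fun K v = supp_fun (T K) (- \<phi>) + a" if "K \<in> ball_bodies" for K
      using f[OF that] width_nonneg[OF ball_bodiesD(1,3)[OF T[OF that]], of \<phi>] by simp
    then show ?thesis using \<phi> by (intro exI[of _ "- \<phi>"]) auto
  next
    assume "a \<le> b - 2"
    then have "supp_fun K v = b - supp_fun (T K) \<phi>" if "K \<in> ball_bodies" for K
      using f[OF that] ball_bodies_width_le[OF T[OF that] \<phi>] by simp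
    then show ?thesis using \<phi> by (intro exI[of _ "- \<phi>"]) auto
  qed
qed

section \<open>Classification of the isometries\<close>

lemma of_nat_mult_bounded_imp_zero:
  fixes a C :: real
  assumes "\<And>k. real k * \<bar>a\<bar> \<le> C"
  shows "a = 0"
proof (rule ccontr)
  assume "a \<noteq> 0"
  then obtain k where "C < real k * \<bar>a\<bar>" using ex_less_of_nat_mult[of "\<bar>a\<bar>" C] by auto
  with assms[of k] show False by simp
qed

text \<open>The body \<open>T {k *\<^sub>R z}\<close> has diameter at most 2, so rescaled by \<open>1 / k\<close> it
  converges to a single point, whose support function is linear.\<close>
lemma asymptotically_linear_imp_orthogonal:
  fixes g :: "'a::euclidean_space \<Rightarrow> 'a"
  assumes T: "\<And>x. T x \<in> ball_bodies"
    and g: "\<And>u. norm u = 1 \<Longrightarrow> norm (g u) = 1"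
    and supp: "\<And>x u. norm u = 1 \<Longrightarrow> supp_fun (T x) u = x \<bullet> g u + supp_fun (T 0) u"
  obtains G where "orthogonal_transformation G" "\<And>u. norm u = 1 \<Longrightarrow> G u = g u"
proof -
  \<comment> \<open>The positively homogeneous extension of \<open>g\<close> from the
    sphere.\<close>
  define G where "G v = norm v *\<^sub>R g (sgn v)" for v
  obtain x0 where x0: "x0 \<in> T 0" using ball_bodiesD(3)[OF T] by blast
  \<comment> \<open>\<open>norm x0\<close> bounds \<open>x0 \<bullet> u\<close>, and each of the
    bodies \<open>T (k *\<^sub>R z)\<close> and \<open>T 0\<close> contributes at most 2.\<close>
  define C where "C = norm x0 + 4"
  have approx: "\<exists>y. \<forall>v. \<bar>k * (z \<bullet> G v) - y \<bullet> v\<bar> \<le> C * norm v" for k :: real and z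
  proof -
    obtain y where y: "y \<in> T (k *\<^sub>R z)" using ball_bodiesD(3)[OF T] by blast
    have "\<bar>k * (z \<bullet> G v) - y \<bullet> v\<bar> \<le> C * norm v" for v
    proof (cases "v = 0")
      case False
      define u where "u = sgn v"
      have u: "norm u = 1" and v: "v = norm v *\<^sub>R u"
        using False by (simp_all add: u_def norm_sgn sgn_div_norm)
      have "\<bar>x0 \<bullet> u\<bar> \<le> norm x0" using Cauchy_Schwarz_ineq2[of x0 u] u by simp
      then have "\<bar>k * (z \<bullet> g u) - y \<bullet> u\<bar> \<le> C"
        using supp[OF u, of "k *\<^sub>R z"] ball_bodies_supp_fun_le[OF T y u] ball_bodies_supp_fun_le[OF T x0 u]
          supp_fun_upper[OF ball_bodiesD(1)[OF T] y, of u] supp_fun_upper[OF ball_bodiesD(1)[OF T] x0, of u]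
        by (simp add: C_def)
      then have "norm v * \<bar>k * (z \<bullet> g u) - y \<bullet> u\<bar> \<le> norm v * C" by (rule mult_left_mono) simp
      moreover have "k * (z \<bullet> G v) - y \<bullet> v = norm v * (k * (z \<bullet> g u) - y \<bullet> u)"
        by (subst (2) v) (simp add: G_def u_def algebra_simps)
      ultimately show ?thesis by (simp add: abs_mult mult.commute)
    qed (simp add: G_def)
    then show ?thesis by blast
  qed
  have "linear G"
  proof (rule linearI)
    fix v w
    \<comment> \<open>One \<open>y\<close> serves all vectors and is linear in them, so
      \<open>k\<close> times the defect of additivity is bounded independently of
      \<open>k\<close>.\<close>
    have "z \<bullet> (G (v + w) - (G v + G w)) = 0" for z
    proof (rule of_nat_mult_bounded_imp_zero)
      fix k
      obtain y where y: "\<And>v. \<bar>real k * (z \<bullet> G v) - y \<bullet> v\<bar> \<le> C * norm v"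
        using approx by blast
      have "real k * (z \<bullet> (G (v + w) - (G v + G w))) = (real k * (z \<bullet> G (v + w)) - y \<bullet> (v + w))
          - (real k * (z \<bullet> G v) - y \<bullet> v) - (real k * (z \<bullet> G w) - y \<bullet> w)"
        by (simp add: inner_simps algebra_simps)
      then have "\<bar>real k * (z \<bullet> (G (v + w) - (G v + G w)))\<bar> \<le> C * norm (v + w) + C * norm v + C * norm w"
        using y[of "v + w"] y[of v] y[of w] by linarith
      then show "real k * \<bar>z \<bullet> (G (v + w) - (G v + G w))\<bar> \<le> C * norm (v + w) + C * norm v + C * norm w"
        by (simp add: abs_mult)
    qed
    from this[of "G (v + w) - (G v + G w)"] show "G (v + w) = G v + G w" by simp
  next
    fix r :: real and v
    have "z \<bullet> (G (r *\<^sub>R v) - r *\<^sub>R G v) = 0" for z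
    proof (rule of_nat_mult_bounded_imp_zero)
      fix k
      obtain y where y: "\<And>v. \<bar>real k * (z \<bullet> G v) - y \<bullet> v\<bar> \<le> C * norm v"
        using approx by blast
      have "real k * (z \<bullet> (G (r *\<^sub>R v) - r *\<^sub>R G v)) = (real k * (z \<bullet> G (r *\<^sub>R v)) - y \<bullet> (r *\<^sub>R v))
          - r * (real k * (z \<bullet> G v) - y \<bullet> v)"
        by (simp add: inner_simps algebra_simps)
      moreover have "\<bar>r * (real k * (z \<bullet> G v) - y \<bullet> v)\<bar> \<le> \<bar>r\<bar> * (C * norm v)"
        unfolding abs_mult using y[of v] by (intro mult_left_mono) auto
      ultimately have "\<bar>real k * (z \<bullet> (G (r *\<^sub>R v) - r *\<^sub>R G v))\<bar> \<le> C * norm (r *\<^sub>R v) + \<bar>r\<bar> * (C * norm v)"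
        using y[of "r *\<^sub>R v"] by linarith
      then show "real k * \<bar>z \<bullet> (G (r *\<^sub>R v) - r *\<^sub>R G v)\<bar> \<le> C * norm (r *\<^sub>R v) + \<bar>r\<bar> * (C * norm v)"
        by (simp add: abs_mult)
    qed
    from this[of "G (r *\<^sub>R v) - r *\<^sub>R G v"] show "G (r *\<^sub>R v) = r *\<^sub>R G v" by simp
  qed
  moreover have "norm (G v) = norm v" for v
    by (cases "v = 0") (simp_all add: G_def g norm_sgn)
  ultimately have "orthogonal_transformation G" by (simp add: orthogonal_transformation)
  moreover have "G u = g u" if "norm u = 1" for u using that by (simp add: G_def sgn_div_norm)
  ultimately show thesis by (rule that)
qed

lemma mem_c_dual_iff:
  assumes "compact K" "K \<noteq> {}"
  shows "z \<in> c_dual K \<longleftrightarrow> (\<forall>u. norm u = 1 \<longrightarrow> supp_fun K u \<le> z \<bullet> u + 1)"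
  unfolding subset_cball_iff_supp_fun[OF assms, symmetric] c_dual_def by (auto simp: dist_commute)

theorem theorem1:
  fixes T :: "'a::euclidean_space set \<Rightarrow> 'a set"
  assumes "bij_betw T ball_bodies ball_bodies"
    and "\<forall>K\<in>ball_bodies. \<forall>L\<in>ball_bodies.
           hausdorff_dist (T K) (T L) = hausdorff_dist K L"
  shows "\<exists>g. rigid_motion g \<and>
           ((\<forall>K\<in>ball_bodies. T K = g ` K) \<or> (\<forall>K\<in>ball_bodies. T K = g ` c_dual K))"
proof -
  have T: "\<And>K. K \<in> ball_bodies \<Longrightarrow> T K \<in> ball_bodies" using assms(1) bij_betwE by blast
  \<comment> \<open>Applied to the inverse, \<open>isometry_supp_fun\<close> expresses the support
    function of \<open>T K\<close> by that of \<open>K\<close>, from which \<open>T K\<close> can be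
    recovered.\<close>
  define S where "S = inv_into ball_bodies T"
  have bij: "bij_betw S ball_bodies ball_bodies"
    unfolding S_def using assms(1) by (rule bij_betw_inv_into)
  have ST: "S (T K) = K" if "K \<in> ball_bodies" for K
    unfolding S_def using assms(1) that by (rule bij_betw_inv_into_left)
  have TS: "T (S K) = K" if "K \<in> ball_bodies" for K
    unfolding S_def using assms(1) that by (rule bij_betw_inv_into_right)
  have S: "S K \<in> ball_bodies" if "K \<in> ball_bodies" for K using bij bij_betwE that by blast
  have iso: "hausdorff_dist (S K) (S L) = hausdorff_dist K L"
    if "K \<in> ball_bodies" "L \<in> ball_bodies" for K L
    using assms(2) S[OF that(1)] S[OF that(2)] TS that by metis
  define pos where "pos v w \<longleftrightarrow>
    (\<forall>K\<in>ball_bodies. supp_fun (T K) v = supp_fun K w + supp_fun (T {0}) v)" for v w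
  define neg where "neg v w \<longleftrightarrow>
    (\<forall>K\<in>ball_bodies. supp_fun (T K) v = - supp_fun K (- w) + supp_fun (T {0}) v)" for v w
  have "\<exists>w. norm w = 1 \<and> (pos v w \<or> neg v w)" if v: "norm v = 1" for v
  proof -
    obtain w c where w: "norm w = 1" and
      "(\<forall>K\<in>ball_bodies. supp_fun K v = supp_fun (S K) w + c) \<or>
       (\<forall>K\<in>ball_bodies. supp_fun K v = c - supp_fun (S K) (- w))"
      using isometry_supp_fun[OF bij iso v] by blast
    then have "(\<forall>K\<in>ball_bodies. supp_fun (T K) v = supp_fun K w + c) \<or>
       (\<forall>K\<in>ball_bodies. supp_fun (T K) v = c - supp_fun K (- w))"
      using T ST by metis
    then have "pos v w \<or> neg v w"
      unfolding pos_def neg_def using singleton_in_ball_bodies[of 0] by force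
    with w show ?thesis by blast
  qed
  then obtain g where g: "\<And>v. norm v = 1 \<Longrightarrow> norm (g v) = 1"
    and pn: "\<And>v. norm v = 1 \<Longrightarrow> pos v (g v) \<or> neg v (g v)" by metis
  \<comment> \<open>On singletons \<open>pos\<close> and \<open>neg\<close> give the same formula,
    so the orthogonal map is found before the alternatives are told apart.\<close>
  obtain G where G: "orthogonal_transformation G" and Gg: "\<And>u. norm u = 1 \<Longrightarrow> G u = g u"
  proof (rule asymptotically_linear_imp_orthogonal[of "\<lambda>x. T {x}" g])
    fix x u :: 'a assume "norm u = 1"
    from pn[OF this] show "supp_fun (T {x}) u = x \<bullet> g u + supp_fun (T {0}) u"
      unfolding pos_def neg_def using singleton_in_ball_bodies[of x] by auto
  qed (use g T singleton_in_ball_bodies in auto)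
  have pn: "pos v (G v) \<or> neg v (G v)" if "norm v = 1" for v using pn[OF that] Gg[OF that] by simp
  have Gneg: "G (- v) = - G v" for v
    using orthogonal_transformation_linear[OF G] by (rule linear_neg)
  have normG: "norm (G v) = norm v" for v using G by (rule orthogonal_transformation_norm)
  define width where "width K v = supp_fun K v + supp_fun K (- v)" for K and v :: 'a
  \<comment> \<open>With different alternatives at \<open>v\<close> and \<open>- v\<close> the
    contributions of \<open>K\<close> cancel in the width of \<open>T K\<close>. By surjectivity all
    ball bodies would then have equal width in direction \<open>v\<close>, but a point and a unit
    ball do not.\<close>
  have mixed: False if v: "norm v = 1" and "pos v (G v)" "neg (- v) (G (- v))" for v
  proof -
    have "width (T K) v = width (T {0}) v" if "K \<in> ball_bodies" for K
      using \<open>pos v (G v)\<close> \<open>neg (- v) (G (- v))\<close> that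
      by (simp add: pos_def neg_def width_def Gneg)
    then have "width K v = width L v" if "K \<in> ball_bodies" "L \<in> ball_bodies" for K L
      using S TS that by metis
    from this[OF singleton_in_ball_bodies cball_in_ball_bodies, of 1 0 0] v show False
      by (simp add: width_def supp_fun_cball)
  qed
  define f where "f = inv G"
  have f: "orthogonal_transformation f" and Gf: "\<And>x. G (f x) = x" and fG: "\<And>x. f (G x) = x"
    using G orthogonal_transformation_inv[OF G] orthogonal_transformation_bij[OF G]
    by (auto simp: f_def bij_is_surj surj_f_inv_f bij_is_inj)
  have inner_G: "y \<bullet> v = G y \<bullet> G v" for y v using G by (simp add: orthogonal_transformation_def)
  have rigid: "rigid_motion (\<lambda>x. f x + p)" for p using f by (auto simp: rigid_motion_def)
  have img: "y \<in> (\<lambda>x. f x + p) ` X \<longleftrightarrow> G (y - p) \<in> X" for y p X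
    using Gf fG by (auto simp: image_iff) (metis add.commute diff_add_cancel)
  have all_G: "(\<forall>v. norm v = 1 \<longrightarrow> P (G v)) \<longleftrightarrow> (\<forall>w. norm w = 1 \<longrightarrow> P w)" for P
    using Gf normG by metis
  have memT: "y \<in> T K \<longleftrightarrow> (\<forall>v. norm v = 1 \<longrightarrow> y \<bullet> v \<le> supp_fun (T K) v)" if "K \<in> ball_bodies" for K y
    using mem_iff_supp_fun[OF ball_bodiesD[OF T[OF that]]] .
  show ?thesis
  proof (cases "\<exists>v. norm v = 1 \<and> pos v (G v)")
    case True
    then obtain v where v: "norm v = 1" "pos v (G v)" by blast
    have "pos (- v) (G (- v))" using pn[of "- v"] mixed[OF v] v by auto
    \<comment> \<open>The unit ball already has the maximal width 2, which leaves width 0 for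
      \<open>T {0}\<close>.\<close>
    with v have "width (T K) v = width K (G v) + width (T {0}) v" if "K \<in> ball_bodies" for K
      using that by (simp add: pos_def width_def Gneg)
    from this[OF cball_in_ball_bodies, of 1 0]
    have "width (T (cball 0 1)) v = width (cball 0 1) (G v) + width (T {0}) v" by simp
    moreover have "width (cball 0 1) (G v) = 2" using v normG by (simp add: width_def supp_fun_cball)
    moreover have "width (T (cball 0 1)) v \<le> 2"
      unfolding width_def by (intro ball_bodies_width_le T cball_in_ball_bodies v) auto
    ultimately have "width (T {0}) v = 0"
      using width_nonneg[OF ball_bodiesD(1,3)[OF T[OF singleton_in_ball_bodies[of 0]]], of v]
      unfolding width_def by linarith
    then obtain p where p: "T {0} = {p}"
      using ball_bodies_width_zero[OF T[OF singleton_in_ball_bodies] v(1)] unfolding width_def by blast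
    \<comment> \<open>Since \<open>T {0}\<close> is a point, \<open>neg\<close> would give the image
      of the unit ball a negative width.\<close>
    have "\<not> neg w (G w)" if w: "norm w = 1" for w
    proof
      assume "neg w (G w)"
      moreover have "neg (- w) (G (- w))"
        using pn[of "- w"] mixed[of "- w"] w \<open>neg w (G w)\<close> by auto
      ultimately have "width (T K) w = - width K (G w)" if "K \<in> ball_bodies" for K
        using that by (simp add: neg_def width_def Gneg p)
      from this[OF cball_in_ball_bodies, of 1 0]
      have "width (T (cball 0 1)) w = - width (cball 0 1) (G w)" by simp
      moreover have "width (cball 0 1) (G w) = 2" using w normG by (simp add: width_def supp_fun_cball)
      moreover have "0 \<le> width (T (cball 0 1)) w"
        unfolding width_def by (intro width_nonneg ball_bodiesD T cball_in_ball_bodies) auto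
      ultimately show False by simp
    qed
    with pn have all_pos: "\<And>w. norm w = 1 \<Longrightarrow> pos w (G w)" by blast
    have "T K = (\<lambda>x. f x + p) ` K" if K: "K \<in> ball_bodies" for K
    proof (rule set_eqI)
      fix y
      have "y \<in> T K \<longleftrightarrow> (\<forall>v. norm v = 1 \<longrightarrow> G (y - p) \<bullet> G v \<le> supp_fun K (G v))"
        unfolding memT[OF K] using all_pos K
        by (simp add: pos_def p inner_G[symmetric] inner_diff_left algebra_simps)
      also have "\<dots> \<longleftrightarrow> G (y - p) \<in> K"
        unfolding all_G[of "\<lambda>w. G (y - p) \<bullet> w \<le> supp_fun K w"]
        using mem_iff_supp_fun[OF ball_bodiesD[OF K]] by blast
      finally show "y \<in> T K \<longleftrightarrow> y \<in> (\<lambda>x. f x + p) ` K" by (simp add: img)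
    qed
    then show ?thesis using rigid by blast
  next
    case False
    with pn have all_neg: "\<And>w. norm w = 1 \<Longrightarrow> neg w (G w)" by blast
    \<comment> \<open>Now the unit ball plays the part of \<open>{0}\<close>: its image has width 0,
      hence is a point, and supplies the translation \<open>p\<close>.\<close>
    have TB: "supp_fun (T (cball 0 1)) w = supp_fun (T {0}) w - 1" if "norm w = 1" for w
      using all_neg[OF that] cball_in_ball_bodies[of 1 "0::'a"] that normG by (simp add: neg_def supp_fun_cball)
    obtain v :: 'a where v: "norm v = 1" using norm_Basis SOME_Basis by blast
    have "width (T (cball 0 1)) v = 0"
    proof -
      have "width (T (cball 0 1)) v = width (T {0}) v - 2" using TB[of v] TB[of "- v"] v by (simp add: width_def)
      moreover have "width (T {0}) v \<le> 2"
        unfolding width_def by (intro ball_bodies_width_le T singleton_in_ball_bodies v)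
      moreover have "0 \<le> width (T (cball 0 1)) v"
        unfolding width_def by (intro width_nonneg ball_bodiesD T cball_in_ball_bodies) auto
      ultimately show ?thesis by simp
    qed
    then obtain p where p: "T (cball 0 1) = {p}"
      using ball_bodies_width_zero[OF T[OF cball_in_ball_bodies] v] unfolding width_def by fastforce
    have "T K = (\<lambda>x. f x + p) ` c_dual K" if K: "K \<in> ball_bodies" for K
    proof (rule set_eqI)
      fix y
      \<comment> \<open>Up to the translation \<open>p\<close> and the orthogonal map, this is the
        support function \<open>1 - supp_fun K (- u)\<close> of the c-dual.\<close>
      have TK: "supp_fun (T K) v = p \<bullet> v + 1 - supp_fun K (G (- v))" if "norm v = 1" for v
        using all_neg[OF that] K TB[OF that] by (simp add: neg_def p Gneg)
      have "y \<in> T K \<longleftrightarrow> (\<forall>v. norm v = 1 \<longrightarrow> supp_fun K (G (- v)) \<le> G (y - p) \<bullet> G (- v) + 1)"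
        unfolding memT[OF K] inner_G[symmetric]
      proof (intro all_cong1 imp_cong refl)
        fix v :: 'a assume "norm v = 1"
        then show "(y \<bullet> v \<le> supp_fun (T K) v) = (supp_fun K (G (- v)) \<le> (y - p) \<bullet> (- v) + 1)"
          by (auto simp: TK inner_diff_left)
      qed
      also have "\<dots> \<longleftrightarrow> (\<forall>v. norm v = 1 \<longrightarrow> supp_fun K (G v) \<le> G (y - p) \<bullet> G v + 1)"
        by (metis minus_minus norm_minus_cancel)
      also have "\<dots> \<longleftrightarrow> G (y - p) \<in> c_dual K"
        unfolding all_G[of "\<lambda>w. supp_fun K w \<le> G (y - p) \<bullet> w + 1"]
        using mem_c_dual_iff[OF ball_bodiesD(1,3)[OF K]] by blast
      finally show "y \<in> T K \<longleftrightarrow> y \<in> (\<lambda>x. f x + p) ` c_dual K" by (simp add: img)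
    qed
    then show ?thesis using rigid by blast
  qed
qed

end
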